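(* Let $x\in(0,1)$ be fixed. Then: (1) The functions $p\mapsto \arcsin_p(x)$ and $p\mapsto \operatorname{arctanh}_p(x)$ are strictly completely monotonic and log-convex on $(0,\infty)$. Moreover, $p\mapsto \arcsin_p(x)$ is strictly geometrically convex on $(0,\infty)$. (2) The function $p\mapsto \arctan_p(x)$ is strictly increasing and concave on $(0,\infty)$. In particular, for all $p>1$ and $x\in(0,1)$, $$\arcsin_p^2(x)<\arcsin_{p-1}(x)\arcsin_{p+1}(x),$$ $$\operatorname{arctanh}_p^2(x)<\operatorname{arctanh}_{p-1}(x)\operatorname{arctanh}_{p+1}(x),$$ $$\arctan_p^2(x)>\arctan_{p-1}(x)\arctan_{p+1}(x).$$
   Context: For $x\in(0,1)$ and $p>0$ define $$\arcsin_p(x)=\int_0^x(1-t^p)^{-1/p}\,dt,\quad \arctan_p(x)=\int_0^x(1+t^p)^{-1}\,dt,\quad \operatorname{arctanh}_p(x)=\int_0^x(1-t^p)^{-1}\,dt.$$ The notation $\arcsin_p^2(x)$ means $(\arcsin_p(x))^2$, and similarly for the others. A function $h:(0,\infty)\to\mathbb{R}$ is completely monotonic if it has derivatives of all orders and $(-1)^m h^{(m)}(y)\ge 0$ for all $y>0$ and $m\in\{0,1,2,\dots\}$; it is strictly completely monotonic if these inequalities are all strict. A function $f:(0,\infty)\to(0,\infty)$ is log-convex if $\ln f$ is convex. A function $g:(0,\infty)\to(0,\infty)$ is geometrically convex if $g(u^{\lambda}v^{1-\lambda})\le g(u)^{\lambda}g(v)^{1-\lambda}$ for all $u,v>0$ and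 $\lambda\in[0,1]$; it is strictly geometrically convex if the inequality is strict whenever $u\ne v$ and $\lambda\in(0,1)$. *)

theory Defs
  imports "HOL-Analysis.Analysis"
begin

text \<open>The values are meaningful for parameters \<open>p > 0\<close> and \<open>0 < x < 1\<close>. There the integrands
  are continuous on \<open>{0..x}\<close>; in particular \<open>0 powr p = 0\<close> is the usual power \<open>0^p\<close>.\<close>

definition arcsin_p :: "real \<Rightarrow> real \<Rightarrow> real" where
  "arcsin_p p x = integral {0..x} (\<lambda>t. (1 - t powr p) powr (-(1 / p)))"

definition arctan_p :: "real \<Rightarrow> real \<Rightarrow> real" where
  "arctan_p p x = integral {0..x} (\<lambda>t. inverse (1 + t powr p))"

definition artanh_p :: "real \<Rightarrow> real \<Rightarrow> real" where
  "artanh_p p x = integral {0..x} (\<lambda>t. inverse (1 - t powr p))"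

text \<open>Functions on \<open>(0,\<infinity>)\<close> are represented by total functions on \<open>real\<close>; every property
  below depends only on their values on \<open>{0<..}\<close>. As this set is open, \<open>deriv\<close> at a point of
  it is the usual derivative, given differentiability, which has to be required explicitly since
  \<open>deriv\<close> is total.\<close>

definition completely_monotonic :: "(real \<Rightarrow> real) \<Rightarrow> bool" where
  "completely_monotonic h \<longleftrightarrow>
     (\<forall>m. \<forall>y>0. (deriv ^^ m) h field_differentiable (at y)) \<and>
     (\<forall>m. \<forall>y>0. (-1) ^ m * (deriv ^^ m) h y \<ge> 0)"

definition strictly_completely_monotonic :: "(real \<Rightarrow> real) \<Rightarrow> bool" where
  "strictly_completely_monotonic h \<longleftrightarrow>
     completely_monotonic h \<and> (\<forall>m. \<forall>y>0. (-1) ^ m * (deriv ^^ m) h y > 0)"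

definition log_convex :: "(real \<Rightarrow> real) \<Rightarrow> bool" where
  "log_convex f \<longleftrightarrow> (\<forall>y>0. f y > 0) \<and> convex_on {0<..} (\<lambda>y. ln (f y))"

definition geometrically_convex :: "(real \<Rightarrow> real) \<Rightarrow> bool" where
  "geometrically_convex g \<longleftrightarrow>
     (\<forall>y>0. g y > 0) \<and>
     (\<forall>u>0. \<forall>v>0. \<forall>l\<in>{0..1}.
        g (u powr l * v powr (1 - l)) \<le> g u powr l * g v powr (1 - l))"

definition strictly_geometrically_convex :: "(real \<Rightarrow> real) \<Rightarrow> bool" where
  "strictly_geometrically_convex g \<longleftrightarrow>
     geometrically_convex g \<and>
     (\<forall>u>0. \<forall>v>0. \<forall>l\<in>{0<..<1}. u \<noteq> v \<longrightarrow>
        g (u powr l * v powr (1 - l)) < g u powr l * g v powr (1 - l))"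

end

theory Submission
  imports Defs
begin

text \<open>For fixed \<open>0 < t < 1\<close> the integrands are, as functions of \<open>p\<close>, built by sums, products and
  exponentials from \<open>t\<^sup>p\<close>, \<open>1/p\<close>, \<open>1/(1 - t\<^sup>p)\<close> and \<open>L p = - ln (1 - t\<^sup>p)\<close>, for instance
  \<open>(1 - t\<^sup>p) powr (-1/p) = exp (L p / p)\<close>. Differentiating such an expression and changing the
  sign gives another such expression, so the integrands are strictly completely monotonic, and this
  passes to integrals by dominated convergence. Their logarithms \<open>L p / p\<close> and \<open>L p\<close> belong to the
  same class, hence are strictly convex; moreover \<open>L p / p\<close> is strictly convex in \<open>ln p\<close> because
  \<open>L\<close> is positive, decreasing and convex. Hoelder's inequality, in the form of Young's inequality
  for normalized functions, carries log-convexity and geometric convexity over to the integrals. The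
  integrand \<open>1/(1 + t\<^sup>p)\<close> is strictly increasing and strictly concave in \<open>p\<close>, and its Turan
  inequality is the arithmetic-geometric mean inequality.\<close>

section \<open>Iterated derivatives with alternating signs\<close>

text \<open>\<open>D m\<close> plays the role of \<open>(-1) ^ m\<close> times the m-th derivative
  of \<open>D 0\<close>. With the sign absorbed, every member is positive and no iterated
  \<open>deriv\<close> occurs.\<close>

definition cm_derivs :: "(nat \<Rightarrow> real \<Rightarrow> real) \<Rightarrow> bool" where
  "cm_derivs D \<longleftrightarrow>
     (\<forall>m. \<forall>p>0. 0 < D m p \<and> (D m has_real_derivative - D (Suc m) p) (at p))"

lemma cm_derivsD:
  assumes "cm_derivs D" and "p > 0"
  shows "0 < D m p" and "(D m has_real_derivative - D (Suc m) p) (at p)"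
  using assms by (auto simp: cm_derivs_def)

lemma cm_derivs_strict_antimono:
  assumes D: "cm_derivs D" and "0 < p" and "p < q"
  shows "D m q < D m p"
proof (rule DERIV_neg_imp_decreasing[OF \<open>p < q\<close>])
  fix y assume "p \<le> y" "y \<le> q"
  then have "y > 0" using \<open>0 < p\<close> by simp
  then show "\<exists>d. (D m has_real_derivative d) (at y) \<and> d < 0"
    using cm_derivsD[OF D] by (meson neg_less_0_iff_less)
qed

text \<open>Induction identifies the iterated \<open>deriv\<close> with \<open>D m\<close> up to
  sign. Agreement of \<open>h\<close> with \<open>D 0\<close> for positive arguments suffices,
  because the half-line is open and derivatives are local.\<close>

lemma strictly_completely_monotonicI:
  assumes D: "cm_derivs D" and h: "\<And>p. p > 0 \<Longrightarrow> D 0 p = h p"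
  shows "strictly_completely_monotonic h"
proof -
  have iter: "(deriv ^^ m) h p = (-1) ^ m * D m p \<and>
      ((deriv ^^ m) h has_real_derivative (-1) ^ Suc m * D (Suc m) p) (at p)"
    if "p > 0" for m p
    using that
  proof (induction m arbitrary: p)
    case 0
    have "(h has_real_derivative - D (Suc 0) p) (at p)"
      by (rule has_field_derivative_transform_within_open[OF cm_derivsD(2)[OF D 0], of "{0<..}"])
        (use 0 h in auto)
    then show ?case using h 0 by simp
  next
    case (Suc m)
    have eq: "(deriv ^^ Suc m) h q = (-1) ^ Suc m * D (Suc m) q" if "q > 0" for q
      using Suc.IH[OF that] by (simp add: DERIV_imp_deriv)
    have "((\<lambda>q. (-1) ^ Suc m * D (Suc m) q) has_real_derivative
        (-1) ^ Suc m * - D (Suc (Suc m)) p) (at p)"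
      by (intro DERIV_cmult cm_derivsD(2)[OF D] Suc.prems)
    then have "((deriv ^^ Suc m) h has_real_derivative (-1) ^ Suc m * - D (Suc (Suc m)) p) (at p)"
      by (rule has_field_derivative_transform_within_open[where S = "{0<..}"])
        (use Suc.prems eq in auto)
    then show ?case using eq[OF Suc.prems] by simp
  qed
  have diff: "(deriv ^^ m) h field_differentiable (at p)" if "p > 0" for m p
    using iter[OF that] unfolding field_differentiable_def by blast
  have pos: "(-1) ^ m * (deriv ^^ m) h p > 0" if "p > 0" for m p
  proof -
    have "(-1) ^ m * (deriv ^^ m) h p = ((-1) ^ m * (-1) ^ m) * D m p"
      using iter[OF that, of m] by simp
    also have "\<dots> = D m p" by (simp add: power_mult_distrib[symmetric])
    finally show ?thesis using cm_derivsD(1)[OF D that] by simp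
  qed
  show ?thesis
    unfolding strictly_completely_monotonic_def completely_monotonic_def
    using diff pos by (auto intro: less_imp_le)
qed

lemma strictly_completely_monotonic_pos: "strictly_completely_monotonic h \<Longrightarrow> y > 0 \<Longrightarrow> h y > 0"
  unfolding strictly_completely_monotonic_def by (metis funpow_0 mult_1 power_0)

text \<open>The point of this class of functions is that it contains \<open>- f'\<close> along with \<open>f\<close>, so each
  of its members has derivatives of all orders, with alternating signs.\<close>

inductive cm_term :: "(real \<Rightarrow> real) \<Rightarrow> bool" where
  powr: "0 < t \<Longrightarrow> t < 1 \<Longrightarrow> cm_term (\<lambda>p. t powr p)"
| inverse: "cm_term (\<lambda>p. inverse p)"
| geometric: "0 < t \<Longrightarrow> t < 1 \<Longrightarrow> cm_term (\<lambda>p. inverse (1 - t powr p))"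
| log: "0 < t \<Longrightarrow> t < 1 \<Longrightarrow> cm_term (\<lambda>p. - ln (1 - t powr p))"
| scale: "0 < c \<Longrightarrow> cm_term f \<Longrightarrow> cm_term (\<lambda>p. c * f p)"
| add: "cm_term f \<Longrightarrow> cm_term g \<Longrightarrow> cm_term (\<lambda>p. f p + g p)"
| mult: "cm_term f \<Longrightarrow> cm_term g \<Longrightarrow> cm_term (\<lambda>p. f p * g p)"
| exp: "cm_term f \<Longrightarrow> cm_term (\<lambda>p. exp (f p))"

text \<open>The double sign displays the derivative as the negative of a member of
  \<open>cm_term\<close>: for \<open>t < 1\<close> the factor \<open>- ln t\<close> is
  positive.\<close>

lemma has_real_derivative_powr_exponent:
  fixes t :: real
  assumes "0 < t"
  shows "((\<lambda>p. t powr p) has_real_derivative - (- ln t * t powr p)) (at p within S)"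
  using assms by (auto simp: powr_def intro!: derivative_eq_intros)

text \<open>The value \<open>t = 0\<close> is included because continuity of the integrands is later
  required on a closed interval starting at 0.\<close>

lemma powr_less_one_real:
  fixes t p :: real
  assumes "0 \<le> t" "t < 1" "0 < p"
  shows "t powr p < 1"
  using assms powr01_less_one[of t p] by (cases "t = 0") auto

lemma has_real_derivative_neg_ln_one_minus_powr:
  fixes t :: real
  assumes "0 < t" "t < 1" "0 < p"
  shows "((\<lambda>p. - ln (1 - t powr p)) has_real_derivative
    - (inverse (1 - t powr p) * (- ln t * t powr p))) (at p)"
proof -
  have "((\<lambda>p. 1 - t powr p) has_real_derivative - ln t * t powr p) (at p)"
    using assms by (auto intro!: derivative_eq_intros has_real_derivative_powr_exponent)
  from DERIV_minus[OF DERIV_chain2[OF DERIV_ln this]] show ?thesis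
    using assms powr_less_one_real[of t p] by simp
qed

text \<open>Rule induction. The negated derivative of each generator is a product of generators and
  positive constants. The identities \<open>-(f * g)' = (-f') * g + f * (-g')\<close> and
  \<open>-(exp f)' = (-f') * exp f\<close> keep products and exponentials inside the class.\<close>

lemma cm_term_deriv:
  assumes "cm_term f"
  shows "\<exists>g. cm_term g \<and> (\<forall>p>0. 0 < f p \<and> (f has_real_derivative - g p) (at p))"
  using assms
proof induction
  case (powr t)
  have "cm_term (\<lambda>p. - ln t * t powr p)"
    using powr by (intro cm_term.scale cm_term.powr) auto
  then show ?case using powr has_real_derivative_powr_exponent[of t] by auto
next
  case inverse
  have "cm_term (\<lambda>p. inverse p * inverse p)"
    by (intro cm_term.intros)
  moreover have "(inverse has_real_derivative - (inverse p * inverse p)) (at p)" if "p > 0" for p :: real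
    using that by (auto intro!: derivative_eq_intros)
  ultimately show ?case by force
next
  case (geometric t)
  have "cm_term (\<lambda>p. (inverse (1 - t powr p) * inverse (1 - t powr p)) * (- ln t * t powr p))"
    using geometric by (intro cm_term.mult cm_term.geometric cm_term.scale cm_term.powr) auto
  moreover have "((\<lambda>p. inverse (1 - t powr p)) has_real_derivative
      - ((inverse (1 - t powr p) * inverse (1 - t powr p)) * (- ln t * t powr p))) (at p)"
    if "p > 0" for p
    using geometric that powr_less_one_real[of t p]
    by (auto intro!: derivative_eq_intros has_real_derivative_powr_exponent)
  ultimately show ?case
    using geometric powr_less_one_real[of t] by (intro exI conjI allI impI) auto
next
  case (log t)
  have "cm_term (\<lambda>p. inverse (1 - t powr p) * (- ln t * t powr p))"
    using log by (intro cm_term.mult cm_term.geometric cm_term.scale cm_term.powr) auto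
  moreover have "0 < - ln (1 - t powr p)" if "p > 0" for p
    using log that powr_less_one_real[of t p] by (simp add: ln_less_zero)
  ultimately show ?case
    using log has_real_derivative_neg_ln_one_minus_powr[of t] by (intro exI conjI allI impI) auto
next
  case (scale c f)
  then obtain f' where f': "cm_term f'"
    "\<And>p. p > 0 \<Longrightarrow> 0 < f p \<and> (f has_real_derivative - f' p) (at p)" by blast
  have "((\<lambda>p. c * f p) has_real_derivative - (c * f' p)) (at p)" if "p > 0" for p
    using DERIV_cmult[of f "- f' p" p UNIV c] f'(2)[OF that] by simp
  then show ?case using f' \<open>0 < c\<close> by (intro exI[of _ "\<lambda>p. c * f' p"]) (auto intro: cm_term.intros)
next
  case (add f g)
  then obtain f' g' where f': "cm_term f'"
      "\<And>p. p > 0 \<Longrightarrow> 0 < f p \<and> (f has_real_derivative - f' p) (at p)"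
    and g': "cm_term g'"
      "\<And>p. p > 0 \<Longrightarrow> 0 < g p \<and> (g has_real_derivative - g' p) (at p)" by blast
  have "((\<lambda>p. f p + g p) has_real_derivative - (f' p + g' p)) (at p)" if "p > 0" for p
    using DERIV_add[of f "- f' p" p UNIV g "- g' p"] f'(2)[OF that] g'(2)[OF that] by simp
  then show ?case using f' g'
    by (intro exI[of _ "\<lambda>p. f' p + g' p"]) (auto intro: cm_term.intros add_pos_pos)
next
  case (mult f g)
  then obtain f' g' where f': "cm_term f'"
      "\<And>p. p > 0 \<Longrightarrow> 0 < f p \<and> (f has_real_derivative - f' p) (at p)"
    and g': "cm_term g'"
      "\<And>p. p > 0 \<Longrightarrow> 0 < g p \<and> (g has_real_derivative - g' p) (at p)" by blast
  have "((\<lambda>p. f p * g p) has_real_derivative - (f' p * g p + f p * g' p)) (at p)" if "p > 0" for p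
    using DERIV_mult[of f "- f' p" p UNIV g "- g' p"] f'(2)[OF that] g'(2)[OF that]
    by (simp add: algebra_simps)
  then show ?case using f' g' mult.hyps
    by (intro exI[of _ "\<lambda>p. f' p * g p + f p * g' p"]) (auto intro: cm_term.intros)
next
  case (exp f)
  then obtain f' where f': "cm_term f'"
    "\<And>p. p > 0 \<Longrightarrow> 0 < f p \<and> (f has_real_derivative - f' p) (at p)" by blast
  have "((\<lambda>p. exp (f p)) has_real_derivative - (f' p * exp (f p))) (at p)" if "p > 0" for p
    using f'(2)[OF that] by (auto intro!: derivative_eq_intros)
  then show ?case using f' exp.hyps
    by (intro exI[of _ "\<lambda>p. f' p * exp (f p)"]) (auto intro: cm_term.intros)
qed

text \<open>Dependent choice iterates \<open>cm_term_deriv\<close> from \<open>f\<close>, with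
  membership in \<open>cm_term\<close> as the invariant.\<close>

lemma cm_term_derivs:
  assumes "cm_term f"
  obtains D where "cm_derivs D" and "D 0 = f"
proof -
  have "\<exists>D. \<forall>m. (cm_term (D m) \<and> (m = 0 \<longrightarrow> D m = f)) \<and>
      (\<forall>p>0. 0 < D m p \<and> (D m has_real_derivative - D (Suc m) p) (at p))"
    by (rule dependent_nat_choice) (use assms cm_term_deriv in auto)
  then obtain D where "\<forall>m. (cm_term (D m) \<and> (m = 0 \<longrightarrow> D m = f)) \<and>
      (\<forall>p>0. 0 < D m p \<and> (D m has_real_derivative - D (Suc m) p) (at p))" ..
  then show ?thesis by (intro that[of D]) (auto simp: cm_derivs_def)
qed

lemma cm_term_strict_antimono: "cm_term f \<Longrightarrow> 0 < p \<Longrightarrow> p < q \<Longrightarrow> f q < f p"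
  by (metis cm_term_derivs cm_derivs_strict_antimono)

section \<open>Integrals depending on a parameter\<close>

text \<open>By the mean value theorem between \<open>c / 2\<close> and \<open>c\<close>, the negated
  derivative \<open>f'\<close> takes the value \<open>2 / c * (f (c / 2) - f c)\<close> at some
  point before \<open>q\<close>. A bound by a value of \<open>f\<close> itself inherits
  integrability from \<open>f\<close> when a further variable is present.\<close>

lemma decreasing_derivative_bound:
  fixes f f' :: "real \<Rightarrow> real"
  assumes deriv: "\<And>p. p > 0 \<Longrightarrow> (f has_real_derivative - f' p) (at p)"
    and nonneg: "\<And>p. p > 0 \<Longrightarrow> 0 \<le> f p"
    and antimono: "\<And>p q. 0 < p \<Longrightarrow> p \<le> q \<Longrightarrow> f' q \<le> f' p"
    and "0 < c" "c \<le> q"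
  shows "f' q \<le> 2 / c * f (c / 2)"
proof -
  obtain z where z: "c / 2 < z" "z < c" "f c - f (c / 2) = (c - c / 2) * - f' z"
    using MVT2[of "c / 2" c f "\<lambda>p. - f' p"] deriv \<open>0 < c\<close> by force
  have "f' q \<le> f' z" using z assms by (intro antimono) auto
  also have "f' z = 2 / c * (f (c / 2) - f c)"
    using z(3) \<open>0 < c\<close> by (simp add: field_simps)
  also have "\<dots> \<le> 2 / c * f (c / 2)"
    using nonneg[of c] \<open>0 < c\<close> by (intro mult_left_mono) auto
  finally show ?thesis .
qed

lemma decreasing_derivative_lipschitz:
  fixes f f' :: "real \<Rightarrow> real"
  assumes deriv: "\<And>p. p > 0 \<Longrightarrow> (f has_real_derivative - f' p) (at p)"
    and bound: "\<And>p. p \<ge> c \<Longrightarrow> \<bar>f' p\<bar> \<le> B"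
    and "0 < c" "c \<le> p" "c \<le> q" "p \<noteq> q"
  shows "\<bar>(f q - f p) / (q - p)\<bar> \<le> B"
proof -
  have "norm (f q - f p) \<le> B * norm (q - p)"
  proof (rule field_differentiable_bound[of "{c..}" f "\<lambda>p. - f' p"])
    fix z assume "z \<in> {c..}"
    then show "(f has_field_derivative - f' z) (at z within {c..})"
      using deriv[of z] \<open>0 < c\<close> by (auto intro: has_field_derivative_at_within)
  qed (use assms in auto)
  then show ?thesis using \<open>p \<noteq> q\<close> by (simp add: abs_divide divide_simps)
qed

text \<open>Since \<open>G'\<close> is decreasing in the parameter, \<open>G' q \<le> 2 / c * G (c / 2)\<close> for all \<open>q \<ge> c\<close>,
  so the difference quotients are dominated by an integrable function.\<close>

lemma has_real_derivative_integral_antimono: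
  fixes G G' :: "real \<Rightarrow> 'a \<Rightarrow> real"
  assumes deriv: "\<And>p t. p > 0 \<Longrightarrow> t \<in> space M \<Longrightarrow>
        ((\<lambda>p. G p t) has_real_derivative - G' p t) (at p)"
    and nonneg: "\<And>p t. p > 0 \<Longrightarrow> t \<in> space M \<Longrightarrow> 0 \<le> G p t"
    and nonneg': "\<And>p t. p > 0 \<Longrightarrow> t \<in> space M \<Longrightarrow> 0 \<le> G' p t"
    and antimono: "\<And>p q t. 0 < p \<Longrightarrow> p \<le> q \<Longrightarrow> t \<in> space M \<Longrightarrow> G' q t \<le> G' p t"
    and int: "\<And>p. p > 0 \<Longrightarrow> integrable M (G p)"
    and "0 < p"
  shows "integrable M (G' p)"
    and "((\<lambda>p. \<integral>t. G p t \<partial>M) has_real_derivative - (\<integral>t. G' p t \<partial>M)) (at p)"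
proof -
  \<comment> \<open>Any threshold strictly between 0 and \<open>p\<close> would do: all quotients
    with \<open>q > c\<close> share the majorant \<open>w\<close>, whose parameter
    \<open>c / 2\<close> is still positive.\<close>
  define c where "c = p / 2"
  define w where "w t = 2 / c * G (c / 2) t" for t
  define quot where "quot q t = (G q t - G p t) / (q - p)" for q t
  have c: "0 < c" "c < p" using \<open>0 < p\<close> by (auto simp: c_def)
  have w: "integrable M w" unfolding w_def using int[of "c / 2"] c by auto
  have bound: "\<bar>G' q t\<bar> \<le> w t" if "c \<le> q" "t \<in> space M" for q t
    using decreasing_derivative_bound[of "\<lambda>p. G p t" "\<lambda>p. G' p t" c q]
      deriv nonneg antimono nonneg' that c by (auto simp: w_def)
  have quot_bound: "norm (quot q t) \<le> w t" if "c < q" "q \<noteq> p" "t \<in> space M" for q t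
    using decreasing_derivative_lipschitz[of "\<lambda>p. G p t" "\<lambda>p. G' p t" c "w t" p q]
      deriv bound that c by (auto simp: quot_def)
  have quot_int: "integrable M (quot q)" if "c < q" for q
    unfolding quot_def using int[of q] int[of p] that c by auto
  have quot_lim: "(\<lambda>i. quot (X i) t) \<longlonglongrightarrow> - G' p t"
    if X: "\<And>i. X i \<in> {c<..} - {p}" "X \<longlonglongrightarrow> p" and t: "t \<in> space M" for X t
  proof -
    have "((\<lambda>q. (G q t - G p t) / (q - p)) \<longlongrightarrow> - G' p t) (at p within {c<..})"
      using has_field_derivative_at_within[OF deriv[OF \<open>0 < p\<close> t]]
      unfolding has_field_derivative_iff .
    then show ?thesis
      using X unfolding tendsto_at_iff_sequentially quot_def comp_def by blast
  qed
  \<comment> \<open>One concrete sequence tending to \<open>p\<close> exhibits \<open>G' p\<close>,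
    up to sign, as a pointwise limit of measurable quotients. This yields its measurability and, by
    domination, its integrability.\<close>
  define X where "X = (\<lambda>i. p + 1 / real (Suc i))"
  have X: "\<And>i. X i \<in> {c<..} - {p}" "X \<longlonglongrightarrow> p"
    using c LIMSEQ_inverse_real_of_nat_add[of p]
    by (auto simp: X_def inverse_eq_divide intro: add_strict_increasing2 less_trans[of c p])
  have quot_meas: "quot q \<in> borel_measurable M" if "q \<in> {c<..} - {p}" for q
    using quot_int[of q] that by (intro borel_measurable_integrable) simp
  have meas: "(\<lambda>t. - G' p t) \<in> borel_measurable M"
    by (rule borel_measurable_LIMSEQ_real[OF quot_lim[OF X] quot_meas[OF X(1)]])
  have "integrable M (\<lambda>t. - G' p t)"
  proof (rule integrable_dominated_convergence[OF meas _ w])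
    show "quot (X i) \<in> borel_measurable M" for i by (rule quot_meas[OF X(1)])
    show "AE t in M. (\<lambda>i. quot (X i) t) \<longlonglongrightarrow> - G' p t" using quot_lim[OF X] by (rule AE_I2)
    show "AE t in M. norm (quot (X i) t) \<le> w t" for i
      using quot_bound[of "X i"] X(1)[of i] by (intro AE_I2) simp
  qed
  then show "integrable M (G' p)" by simp
  \<comment> \<open>Dominated convergence is a statement about sequences, so the limit is taken
    along an arbitrary sequence in \<open>{c<..}\<close>; as this set is open, it is also the limit
    at \<open>p\<close>.\<close>
  have "((\<lambda>q. \<integral>t. quot q t \<partial>M) \<longlongrightarrow> (\<integral>t. - G' p t \<partial>M)) (at p within {c<..})"
    unfolding tendsto_at_iff_sequentially
  proof (intro allI impI)
    fix Y :: "nat \<Rightarrow> real" assume Y: "\<forall>i. Y i \<in> {c<..} - {p}" "Y \<longlonglongrightarrow> p"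
    show "((\<lambda>q. \<integral>t. quot q t \<partial>M) \<circ> Y) \<longlonglongrightarrow> (\<integral>t. - G' p t \<partial>M)"
      unfolding comp_def
    proof (rule integral_dominated_convergence[OF meas _ w])
      show "quot (Y i) \<in> borel_measurable M" for i
        using Y(1) by (intro quot_meas) simp
      show "AE t in M. (\<lambda>i. quot (Y i) t) \<longlonglongrightarrow> - G' p t"
        by (intro AE_I2 quot_lim[OF _ Y(2)]) (use Y(1) in simp)
      show "AE t in M. norm (quot (Y i) t) \<le> w t" for i
        using quot_bound[of "Y i"] Y(1)[rule_format, of i] by (intro AE_I2) simp
    qed
  qed
  then have "((\<lambda>q. \<integral>t. quot q t \<partial>M) \<longlongrightarrow> - (\<integral>t. G' p t \<partial>M)) (at p)"
    using at_within_open[of p "{c<..}"] c(2) by simp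
  moreover have "\<forall>\<^sub>F q in at p.
      (\<integral>t. quot q t \<partial>M) = ((\<integral>t. G q t \<partial>M) - (\<integral>t. G p t \<partial>M)) / (q - p)"
  proof -
    have eq: "(\<integral>t. quot q t \<partial>M) = ((\<integral>t. G q t \<partial>M) - (\<integral>t. G p t \<partial>M)) / (q - p)"
      if "q \<in> {c<..}" for q
      unfolding quot_def using int[of q] int[of p] that c \<open>0 < p\<close> by simp
    have "\<forall>\<^sub>F q in at p. q \<in> {c<..}"
      by (rule eventually_at_in_open') (use c in auto)
    then show ?thesis by (rule eventually_mono) (rule eq)
  qed
  ultimately show "((\<lambda>p. \<integral>t. G p t \<partial>M) has_real_derivative - (\<integral>t. G' p t \<partial>M)) (at p)"
    unfolding has_field_derivative_iff by (rule Lim_transform_eventually)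
qed

section \<open>Strict inequalities and complete monotonicity under the integral sign\<close>

text \<open>If the integrals were equal, the nonnegative difference \<open>g - f\<close> would
  vanish almost everywhere. Since it is positive everywhere, the whole space would be a null
  set.\<close>

lemma integral_strict_mono:
  fixes f g :: "'a \<Rightarrow> real"
  assumes int: "integrable M f" "integrable M g"
    and less: "\<And>t. t \<in> space M \<Longrightarrow> f t < g t"
    and M: "emeasure M (space M) \<noteq> 0"
  shows "(\<integral>t. f t \<partial>M) < (\<integral>t. g t \<partial>M)"
proof -
  have int': "integrable M (\<lambda>t. g t - f t)" using int by simp
  have nonneg: "AE t in M. 0 \<le> g t - f t" using less by (auto intro!: AE_I2 less_imp_le)
  have "(\<integral>t. g t - f t \<partial>M) \<noteq> 0"
  proof
    assume "(\<integral>t. g t - f t \<partial>M) = 0"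
    then have "AE t in M. g t - f t = 0"
      using integral_nonneg_eq_0_iff_AE[OF int' nonneg] by simp
    moreover have "AE t in M. f t < g t" using less by (rule AE_I2)
    ultimately have "AE t in M. False" by eventually_elim simp
    then show False
      using M by (simp add: ae_filter_eq_bot_iff[symmetric] trivial_limit_def)
  qed
  moreover have "0 \<le> (\<integral>t. g t - f t \<partial>M)" by (rule integral_nonneg_AE[OF nonneg])
  ultimately show ?thesis using int by simp
qed

lemma integral_pos:
  fixes f :: "'a \<Rightarrow> real"
  assumes "integrable M f" "\<And>t. t \<in> space M \<Longrightarrow> 0 < f t" "emeasure M (space M) \<noteq> 0"
  shows "0 < (\<integral>t. f t \<partial>M)"
  using integral_strict_mono[of M "\<lambda>_. 0" f] assms by simp

text \<open>Integrability of \<open>D 0\<close> propagates: each differentiation under the integral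
  also delivers integrability of the next member.\<close>

lemma cm_derivs_integral:
  assumes D: "\<And>t. t \<in> space M \<Longrightarrow> cm_derivs (\<lambda>m p. D m p t)"
    and int: "\<And>p. p > 0 \<Longrightarrow> integrable M (D 0 p)"
    and M: "emeasure M (space M) \<noteq> 0"
  shows "cm_derivs (\<lambda>m p. \<integral>t. D m p t \<partial>M)"
proof -
  note DD = cm_derivsD[OF D]
  have anti: "D m q t \<le> D m p t" if "0 < p" "p \<le> q" "t \<in> space M" for m p q t
    using cm_derivs_strict_antimono[OF D[OF that(3)], of p q m] that by (cases "p = q") auto
  have step: "integrable M (D (Suc m) p) \<and>
      ((\<lambda>p. \<integral>t. D m p t \<partial>M) has_real_derivative - (\<integral>t. D (Suc m) p t \<partial>M)) (at p)"
    if "\<And>p. p > 0 \<Longrightarrow> integrable M (D m p)" "p > 0" for m p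
    using has_real_derivative_integral_antimono[of M "D m" "D (Suc m)" p] DD anti that
    by (simp add: less_imp_le)
  have "integrable M (D m p)" if "p > 0" for m p
    using that by (induction m arbitrary: p) (use int step in auto)
  then show ?thesis
    unfolding cm_derivs_def using step DD(1) M by (auto intro!: integral_pos)
qed

lemma strictly_completely_monotonic_integral:
  assumes F: "\<And>t. t \<in> space M \<Longrightarrow> cm_term (\<lambda>p. F p t)"
    and int: "\<And>p. p > 0 \<Longrightarrow> integrable M (F p)"
    and M: "emeasure M (space M) \<noteq> 0"
    and h: "\<And>p. p > 0 \<Longrightarrow> h p = (\<integral>t. F p t \<partial>M)"
  shows "strictly_completely_monotonic h"
proof -
  have "\<exists>D. cm_derivs D \<and> D 0 = (\<lambda>p. F p t)" if "t \<in> space M" for t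
    using cm_term_derivs[OF F[OF that]] by metis
  \<comment> \<open>The sequence is chosen separately for each \<open>t\<close>; measurability in
    \<open>t\<close> of its higher members is a by-product of differentiating under the
    integral.\<close>
  then obtain D where D: "\<And>t. t \<in> space M \<Longrightarrow> cm_derivs (D t)"
    "\<And>t. t \<in> space M \<Longrightarrow> D t 0 = (\<lambda>p. F p t)" by metis
  have "cm_derivs (\<lambda>m p. \<integral>t. D t m p \<partial>M)"
    using D int M by (intro cm_derivs_integral) (auto cong: Bochner_Integration.integrable_cong)
  moreover have "(\<integral>t. D t 0 p \<partial>M) = (\<integral>t. F p t \<partial>M)" for p
    using D(2) by (intro Bochner_Integration.integral_cong) auto
  ultimately show ?thesis
    using h strictly_completely_monotonicI[of "\<lambda>m p. \<integral>t. D t m p \<partial>M" h] by simp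
qed

text \<open>Hoelder's inequality with exponents \<open>1 / l\<close> and \<open>1 / (1 - l)\<close>.
  After division by the integrals \<open>A\<close> and \<open>B\<close>, Young's inequality bounds
  the geometric mean by an arithmetic mean with integral \<open>l + (1 - l) = 1\<close>. Strictness
  comes from the pointwise bound on \<open>h\<close>.\<close>

lemma integral_less_geometric_mean:
  fixes f g h :: "'a \<Rightarrow> real"
  assumes int: "integrable M f" "integrable M g" "integrable M h"
    and pos: "\<And>t. t \<in> space M \<Longrightarrow> 0 < f t" "\<And>t. t \<in> space M \<Longrightarrow> 0 < g t"
    and l: "0 < l" "l < 1"
    and less: "\<And>t. t \<in> space M \<Longrightarrow> h t < f t powr l * g t powr (1 - l)"
    and M: "emeasure M (space M) \<noteq> 0"
  shows "(\<integral>t. h t \<partial>M) < (\<integral>t. f t \<partial>M) powr l * (\<integral>t. g t \<partial>M) powr (1 - l)"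
proof -
  define A B where "A = (\<integral>t. f t \<partial>M)" and "B = (\<integral>t. g t \<partial>M)"
  define C where "C = A powr l * B powr (1 - l)"
  have AB: "A > 0" "B > 0" using integral_pos int pos M by (auto simp: A_def B_def)
  have "h t < C * (l * (f t / A) + (1 - l) * (g t / B))" if t: "t \<in> space M" for t
  proof -
    have "f t powr l * g t powr (1 - l) = C * ((f t / A) powr l * (g t / B) powr (1 - l))"
      using AB pos[OF t] by (simp add: C_def powr_divide)
    also have "\<dots> \<le> C * (l * (f t / A) + (1 - l) * (g t / B))"
      using AB pos[OF t] l by (intro mult_left_mono Youngs_inequality_0) (auto simp: C_def)
    finally show ?thesis using less[OF t] by simp
  qed
  then have "(\<integral>t. h t \<partial>M) < (\<integral>t. C * (l * (f t / A) + (1 - l) * (g t / B)) \<partial>M)"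
    using int M by (intro integral_strict_mono) auto
  also have "\<dots> = C * (l * (A / A) + (1 - l) * (B / B))"
    using int by (simp add: A_def B_def)
  also have "\<dots> = C" using AB by simp
  finally show ?thesis by (simp add: C_def A_def B_def)
qed

section \<open>Convexity of the integrands\<close>

text \<open>The mean value theorem on both sides of the intermediate point \<open>w\<close> gives
  slopes \<open>f' y < f' z\<close>. The distances from \<open>w\<close> to \<open>u\<close> and
  \<open>v\<close> are in the ratio \<open>1 - l\<close> to \<open>l\<close>, which turns the slope
  comparison into the claim.\<close>

lemma strict_convex_of_strict_mono_derivative:
  fixes f f' :: "real \<Rightarrow> real"
  assumes S: "convex S"
    and deriv: "\<And>y. y \<in> S \<Longrightarrow> (f has_real_derivative f' y) (at y)"
    and mono: "strict_mono_on S f'"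
    and uv: "u \<in> S" "v \<in> S" "u \<noteq> v" and l: "0 < l" "l < 1"
  shows "f (l * u + (1 - l) * v) < l * f u + (1 - l) * f v"
proof -
  have key: "f (l * u + (1 - l) * v) < l * f u + (1 - l) * f v"
    if uv: "u \<in> S" "v \<in> S" "u < v" and l: "0 < l" "l < 1" for u v l
  proof -
    define w where "w = l * u + (1 - l) * v"
    have wu: "w - u = (1 - l) * (v - u)" and vw: "v - w = l * (v - u)"
      by (auto simp: w_def algebra_simps)
    have "w - u > 0" "v - w > 0" unfolding wu vw using uv l by auto
    then have w: "u < w" "w < v" by auto
    have sub: "{u..v} \<subseteq> S"
      using S uv by (simp add: closed_segment_eq_real_ivl convex_contains_segment split: if_splits)
    obtain y where y: "u < y" "y < w" "f w - f u = (w - u) * f' y"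
      using MVT2[of u w f f'] w sub deriv by (auto simp: subset_iff)
    obtain z where z: "w < z" "z < v" "f v - f w = (v - w) * f' z"
      using MVT2[of w v f f'] w sub deriv by (auto simp: subset_iff)
    have "f' y < f' z"
      using y z sub by (intro strict_mono_onD[OF mono]) auto
    then have "l * (1 - l) * (v - u) * f' y < l * (1 - l) * (v - u) * f' z"
      using uv l by (intro mult_strict_left_mono) auto
    then have "l * (f w - f u) < (1 - l) * (f v - f w)"
      unfolding y z wu vw by (simp add: mult_ac)
    then show ?thesis unfolding w_def[symmetric] by (simp add: algebra_simps)
  qed
  show ?thesis
  proof (cases "u < v")
    case True
    then show ?thesis using key[of u v l] uv l by simp
  next
    case False
    then show ?thesis using key[of v u "1 - l"] uv l by (simp add: add.commute)
  qed
qed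

lemma cm_term_strict_convex:
  assumes f: "cm_term f" and uv: "0 < u" "0 < v" "u \<noteq> v" and l: "0 < l" "l < 1"
  shows "f (l * u + (1 - l) * v) < l * f u + (1 - l) * f v"
proof -
  obtain g where g: "cm_term g" "\<And>p. p > 0 \<Longrightarrow> (f has_real_derivative - g p) (at p)"
    using cm_term_deriv[OF f] by blast
  have "strict_mono_on {0<..} (\<lambda>p. - g p)"
    using cm_term_strict_antimono[OF g(1)] by (auto simp: strict_mono_on_def)
  then show ?thesis
    using strict_convex_of_strict_mono_derivative[of "{0<..}" f "\<lambda>p. - g p" u v l] g(2) uv l
    by auto
qed

text \<open>For \<open>\<psi> s = f (exp s) / exp s\<close> one has \<open>\<psi>' s = f' q - f q / q\<close> with \<open>q = exp s\<close>, which is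
  increasing because \<open>- f'\<close> and \<open>f\<close> are decreasing and positive.\<close>

lemma cm_term_div_strict_convex_exp:
  assumes f: "cm_term f" and uv: "u \<noteq> v" and l: "0 < l" "l < 1"
  shows "f (exp (l * u + (1 - l) * v)) * inverse (exp (l * u + (1 - l) * v))
     < l * (f (exp u) * inverse (exp u)) + (1 - l) * (f (exp v) * inverse (exp v))"
proof -
  obtain g where g: "cm_term g" "\<And>p. p > 0 \<Longrightarrow> (f has_real_derivative - g p) (at p)"
    using cm_term_deriv[OF f] by blast
  define \<psi>' where "\<psi>' s = - (g (exp s) + f (exp s) * inverse (exp s))" for s
  have deriv: "((\<lambda>s. f (exp s) * inverse (exp s)) has_real_derivative \<psi>' s) (at s)" for s
    unfolding \<psi>'_def
    by (auto intro!: derivative_eq_intros DERIV_chain2[OF g(2)] simp: field_simps)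
  \<comment> \<open>The function under the minus sign in \<open>\<psi>'\<close> is a class member
    evaluated at \<open>exp s\<close>, so it decreases strictly in \<open>s\<close>.\<close>
  have "cm_term (\<lambda>p. g p + f p * inverse p)"
    using f g(1) by (intro cm_term.add cm_term.mult cm_term.inverse)
  then have "strict_mono_on UNIV \<psi>'"
    by (intro strict_mono_onI) (simp only: \<psi>'_def neg_less_iff_less, rule cm_term_strict_antimono, auto)
  from strict_convex_of_strict_mono_derivative[OF convex_UNIV deriv this UNIV_I UNIV_I uv l]
  show ?thesis .
qed

text \<open>The negated function has derivative \<open>ln t * z / (1 + z)^2\<close> with
  \<open>z = t powr p\<close>. As \<open>p\<close> grows, \<open>z\<close> falls within (0,1), where
  \<open>z / (1 + z)^2\<close> is increasing; the negative factor \<open>ln t\<close> makes the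
  derivative increase.\<close>

lemma inverse_one_plus_powr_strict_concave:
  fixes t :: real
  assumes t: "0 < t" "t < 1" and uv: "0 < u" "0 < v" "u \<noteq> v" and l: "0 < l" "l < 1"
  shows "l * inverse (1 + t powr u) + (1 - l) * inverse (1 + t powr v)
    < inverse (1 + t powr (l * u + (1 - l) * v))"
proof -
  define f' where "f' p = ln t * (t powr p / (1 + t powr p)\<^sup>2)" for p
  have nz: "1 + t powr p \<noteq> 0" for p using powr_ge_zero[of t p] by linarith
  have deriv: "((\<lambda>p. - inverse (1 + t powr p)) has_real_derivative f' p) (at p)" for p
    unfolding f'_def using nz[of p] t
    by (auto intro!: derivative_eq_intros has_real_derivative_powr_exponent
        simp: field_simps power2_eq_square)
  have "strict_mono_on {0<..} f'"
  proof (rule strict_mono_onI)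
    fix p q :: real assume pq: "p \<in> {0<..}" "q \<in> {0<..}" "p < q"
    define y z where "y = t powr q" and "z = t powr p"
    have yz: "0 < y" "y < z" "z < 1"
      using pq t powr_less_one_real[of t p] by (auto simp: y_def z_def powr_less_mono')
    \<comment> \<open>This product equals \<open>z * (1 + y)^2 - y * (1 + z)^2\<close>.\<close>
    have "0 < (z - y) * (1 - y * z)"
      using yz mult_strict_mono[of y 1 z 1] by (intro mult_pos_pos) auto
    then have "y * (1 + z)\<^sup>2 < z * (1 + y)\<^sup>2"
      by (simp add: power2_eq_square algebra_simps)
    then have "y / (1 + y)\<^sup>2 < z / (1 + z)\<^sup>2"
      using yz by (simp add: divide_simps)
    then show "f' p < f' q"
      unfolding f'_def y_def z_def by (rule mult_strict_left_mono_neg) (use t in auto)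
  qed
  from strict_convex_of_strict_mono_derivative[OF _ deriv this, of u v l]
  show ?thesis using uv l by simp
qed

lemma exp_strict_convex_combination:
  fixes a b c l :: real
  assumes "c < l * a + (1 - l) * b"
  shows "exp c < exp a powr l * exp b powr (1 - l)"
  using assms by (simp add: powr_def mult_exp_exp)

lemma convex_combination_pos:
  fixes u v l :: real
  assumes "0 < u" "0 < v" "0 < l" "l < 1"
  shows "0 < l * u + (1 - l) * v"
  using assms by (intro add_pos_pos mult_pos_pos) auto

section \<open>From strict mean inequalities to convexity properties and Turan inequalities\<close>

lemma log_convexI:
  assumes pos: "\<And>y. y > 0 \<Longrightarrow> f y > 0"
    and less: "\<And>u v l. 0 < u \<Longrightarrow> 0 < v \<Longrightarrow> u \<noteq> v \<Longrightarrow> 0 < l \<Longrightarrow> l < 1 \<Longrightarrow>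
      f (l * u + (1 - l) * v) < f u powr l * f v powr (1 - l)"
  shows "log_convex f"
  unfolding log_convex_def
proof (intro conjI allI impI convex_onI)
  fix t x y :: real
  assume t: "0 < t" "t < 1" and xy: "x \<in> {0<..}" "y \<in> {0<..}"
  show "ln (f ((1 - t) *\<^sub>R x + t *\<^sub>R y)) \<le> (1 - t) * ln (f x) + t * ln (f y)"
  proof (cases "x = y")
    case True
    then show ?thesis by (simp add: algebra_simps)
  next
    case False
    have "f ((1 - t) * x + t * y) < f x powr (1 - t) * f y powr t"
      using less[of x y "1 - t"] False t xy by simp
    moreover have "0 < (1 - t) * x + t * y"
      using t xy by (intro add_pos_pos mult_pos_pos) auto
    ultimately have "ln (f ((1 - t) * x + t * y)) < ln (f x powr (1 - t) * f y powr t)"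
      using pos[of "(1 - t) * x + t * y"] by (intro ln_less_cancel_iff[THEN iffD2]) (auto intro: less_trans)
    also have "\<dots> = (1 - t) * ln (f x) + t * ln (f y)"
      using pos[of x] pos[of y] xy by (simp add: ln_mult ln_powr)
    finally show ?thesis by simp
  qed
qed (use pos in auto)

lemma strictly_geometrically_convexI:
  assumes pos: "\<And>y. y > 0 \<Longrightarrow> f y > 0"
    and less: "\<And>u v l. 0 < u \<Longrightarrow> 0 < v \<Longrightarrow> u \<noteq> v \<Longrightarrow> 0 < l \<Longrightarrow> l < 1 \<Longrightarrow>
      f (u powr l * v powr (1 - l)) < f u powr l * f v powr (1 - l)"
  shows "strictly_geometrically_convex f"
proof -
  have "f (u powr l * v powr (1 - l)) \<le> f u powr l * f v powr (1 - l)"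
    if uv: "0 < u" "0 < v" and l: "l \<in> {0..1}" for u v l
  proof -
    \<comment> \<open>In the first three cases both sides coincide; only the last one uses the
      strict inequality.\<close>
    consider "u = v" | "l = 0" | "l = 1" | "u \<noteq> v" "0 < l" "l < 1" using l by force
    then show ?thesis
      by cases (use uv pos[of u] pos[of v] less in \<open>auto simp: powr_add[symmetric] less_imp_le\<close>)
  qed
  then show ?thesis
    using assms unfolding strictly_geometrically_convex_def geometrically_convex_def by auto
qed

text \<open>This is the case \<open>l = 1 / 2\<close> at \<open>p - 1\<close> and
  \<open>p + 1\<close>, squared; \<open>p > 1\<close> keeps \<open>p - 1\<close> in the
  domain.\<close>

lemma turan_of_strict_log_convex:
  fixes f :: "real \<Rightarrow> real"
  assumes pos: "\<And>y. y > 0 \<Longrightarrow> f y > 0"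
    and less: "\<And>u v l. 0 < u \<Longrightarrow> 0 < v \<Longrightarrow> u \<noteq> v \<Longrightarrow> 0 < l \<Longrightarrow> l < 1 \<Longrightarrow>
      f (l * u + (1 - l) * v) < f u powr l * f v powr (1 - l)"
    and "p > 1"
  shows "(f p)\<^sup>2 < f (p - 1) * f (p + 1)"
proof -
  have "f p < sqrt (f (p - 1)) * sqrt (f (p + 1))"
    using less[of "p - 1" "p + 1" "1 / 2"] pos[of "p - 1"] pos[of "p + 1"] \<open>p > 1\<close>
    by (simp add: powr_half_sqrt field_simps)
  then have "(f p)\<^sup>2 < (sqrt (f (p - 1)) * sqrt (f (p + 1)))\<^sup>2"
    using pos[of p] \<open>p > 1\<close> by (intro power_strict_mono) auto
  then show ?thesis
    using pos[of "p - 1"] pos[of "p + 1"] \<open>p > 1\<close> by (simp add: power_mult_distrib)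
qed

text \<open>Midpoint concavity puts \<open>f p\<close> above the arithmetic mean of the neighbouring
  values, which dominates their geometric mean.\<close>

lemma turan_of_strict_concave:
  fixes f :: "real \<Rightarrow> real"
  assumes pos: "\<And>y. y > 0 \<Longrightarrow> f y > 0"
    and less: "\<And>u v l. 0 < u \<Longrightarrow> 0 < v \<Longrightarrow> u \<noteq> v \<Longrightarrow> 0 < l \<Longrightarrow> l < 1 \<Longrightarrow>
      l * f u + (1 - l) * f v < f (l * u + (1 - l) * v)"
    and "p > 1"
  shows "f (p - 1) * f (p + 1) < (f p)\<^sup>2"
proof -
  have "(f (p - 1) + f (p + 1)) / 2 < f p"
    using less[of "p - 1" "p + 1" "1 / 2"] \<open>p > 1\<close> by (simp add: field_simps)
  then have "((f (p - 1) + f (p + 1)) / 2)\<^sup>2 < (f p)\<^sup>2"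
    using pos[of "p - 1"] pos[of "p + 1"] \<open>p > 1\<close> by (intro power_strict_mono) auto
  moreover have "f (p - 1) * f (p + 1) \<le> ((f (p - 1) + f (p + 1)) / 2)\<^sup>2"
    using zero_le_power2[of "f (p - 1) - f (p + 1)"] by (simp add: power2_eq_square field_simps)
  ultimately show ?thesis by linarith
qed

section \<open>The generalized inverse functions\<close>

lemma emeasure_lebesgue_on_Ioo_pos:
  fixes x :: real
  assumes "0 < x"
  shows "emeasure (lebesgue_on {0<..<x}) (space (lebesgue_on {0<..<x})) \<noteq> 0"
  using assms by (simp add: emeasure_restrict_space)

text \<open>Links the gauge integral over a closed interval, used in the definitions, to a Lebesgue
  integral over the open one. Leaving out the endpoint 0 matters: the generators of
  \<open>cm_term\<close> require \<open>0 < t\<close>.\<close>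

lemma integrable_Ioo_of_continuous:
  fixes f :: "real \<Rightarrow> real"
  assumes "continuous_on {a..b} f"
  shows "integrable (lebesgue_on {a<..<b}) f"
    and "integral {a..b} f = (\<integral>t. f t \<partial>lebesgue_on {a<..<b})"
proof -
  have "f absolutely_integrable_on {a<..<b}"
    using absolutely_integrable_continuous_real[OF assms]
    by (rule set_integrable_subset) auto
  then show int: "integrable (lebesgue_on {a<..<b}) f"
    by (intro absolutely_integrable_imp_integrable) auto
  show "integral {a..b} f = (\<integral>t. f t \<partial>lebesgue_on {a<..<b})"
    using lebesgue_integral_eq_integral[OF int] by (simp add: integral_open_interval_real)
qed

lemma continuous_on_powr_base:
  fixes p x :: real
  assumes "0 < p"
  shows "continuous_on {0..x} (\<lambda>t. t powr p)"
  using assms by (intro continuous_on_powr' continuous_intros) auto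

context
  fixes x :: real
  assumes x: "0 < x" "x < 1"
begin

private abbreviation M where "M \<equiv> lebesgue_on {0<..<x}"

private lemma M_nonzero: "emeasure M (space M) \<noteq> 0"
  using emeasure_lebesgue_on_Ioo_pos x by blast

text \<open>The logarithm of the integrand of \<open>arcsin_p\<close>, written as a product so that
  the rules of \<open>cm_term\<close> apply to it.\<close>

private definition asin_exponent where
  "asin_exponent p t = - ln (1 - t powr p) * inverse p" for p t :: real

private lemma one_minus_powr_pos: "0 < 1 - t powr p" if "t \<in> {0..x}" "0 < p" for t p :: real
  using powr_less_one_real[of t p] that x by auto

private lemma asin_integrand_eq:
  "(1 - t powr p) powr (-(1 / p)) = exp (asin_exponent p t)" if "t \<in> {0..x}" "0 < p"
  using one_minus_powr_pos[OF that] by (simp add: powr_def asin_exponent_def field_simps)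

private lemma cm_term_asin_exponent: "t \<in> space M \<Longrightarrow> cm_term (\<lambda>p. asin_exponent p t)"
  unfolding asin_exponent_def using x by (intro cm_term.mult cm_term.log cm_term.inverse) auto

private lemma continuous_asin: "continuous_on {0..x} (\<lambda>t. exp (asin_exponent p t))" if "0 < p" for p
  unfolding asin_exponent_def using one_minus_powr_pos[OF _ that]
  by (intro continuous_intros continuous_on_powr_base that) (auto simp: less_imp_neq[THEN not_sym])

private lemma continuous_artanh: "continuous_on {0..x} (\<lambda>t. inverse (1 - t powr p))" if "0 < p" for p
  using one_minus_powr_pos[OF _ that]
  by (intro continuous_intros continuous_on_powr_base that) (auto simp: less_imp_neq[THEN not_sym])

private lemma continuous_arctan: "continuous_on {0..x} (\<lambda>t. inverse (1 + t powr p))" if "0 < p" for p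
proof -
  have "1 + t powr p \<noteq> 0" for t using powr_ge_zero[of t p] by linarith
  then show ?thesis by (intro continuous_intros continuous_on_powr_base that) auto
qed

lemma arcsin_p_eq: "arcsin_p p x = (\<integral>t. exp (asin_exponent p t) \<partial>M)" if "0 < p"
proof -
  have "arcsin_p p x = integral {0..x} (\<lambda>t. exp (asin_exponent p t))"
    unfolding arcsin_p_def using asin_integrand_eq that
    by (intro Henstock_Kurzweil_Integration.integral_cong) auto
  then show ?thesis using integrable_Ioo_of_continuous(2)[OF continuous_asin[OF that]] by simp
qed

lemma artanh_p_eq: "artanh_p p x = (\<integral>t. inverse (1 - t powr p) \<partial>M)" if "0 < p"
  unfolding artanh_p_def using integrable_Ioo_of_continuous(2)[OF continuous_artanh[OF that]] .

lemma arctan_p_eq: "arctan_p p x = (\<integral>t. inverse (1 + t powr p) \<partial>M)" if "0 < p"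
  unfolding arctan_p_def using integrable_Ioo_of_continuous(2)[OF continuous_arctan[OF that]] .

private lemmas integrable_asin = integrable_Ioo_of_continuous(1)[OF continuous_asin]
private lemmas integrable_artanh = integrable_Ioo_of_continuous(1)[OF continuous_artanh]
private lemmas integrable_arctan = integrable_Ioo_of_continuous(1)[OF continuous_arctan]

lemma strictly_completely_monotonic_arcsin_p: "strictly_completely_monotonic (\<lambda>p. arcsin_p p x)"
  using cm_term.exp[OF cm_term_asin_exponent] integrable_asin M_nonzero arcsin_p_eq
  by (rule strictly_completely_monotonic_integral)

lemma strictly_completely_monotonic_artanh_p: "strictly_completely_monotonic (\<lambda>p. artanh_p p x)"
  using x integrable_artanh M_nonzero artanh_p_eq
  by (intro strictly_completely_monotonic_integral[of M "\<lambda>p t. inverse (1 - t powr p)"])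
    (auto intro: cm_term.geometric)

lemmas arcsin_p_pos = strictly_completely_monotonic_pos[OF strictly_completely_monotonic_arcsin_p]
lemmas artanh_p_pos = strictly_completely_monotonic_pos[OF strictly_completely_monotonic_artanh_p]

section \<open>Mean inequalities for \<open>arcsin_p\<close> and \<open>artanh_p\<close>\<close>

text \<open>The parameter \<open>w\<close> is left free so that it can be the weighted arithmetic
  mean of \<open>u\<close> and \<open>v\<close> for log-convexity and their geometric mean for
  geometric convexity.\<close>

lemma arcsin_p_less_geometric_mean:
  assumes "0 < u" "0 < v" "0 < w" "0 < l" "l < 1"
    and "\<And>t. t \<in> space M \<Longrightarrow>
      asin_exponent w t < l * asin_exponent u t + (1 - l) * asin_exponent v t"
  shows "arcsin_p w x < arcsin_p u x powr l * arcsin_p v x powr (1 - l)"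
  unfolding arcsin_p_eq[OF assms(1)] arcsin_p_eq[OF assms(2)] arcsin_p_eq[OF assms(3)]
proof (rule integral_less_geometric_mean)
  fix t assume "t \<in> space M"
  then show "exp (asin_exponent w t) < exp (asin_exponent u t) powr l * exp (asin_exponent v t) powr (1 - l)"
    by (intro exp_strict_convex_combination assms)
qed (use assms integrable_asin M_nonzero in auto)

lemma arcsin_p_strict_log_convex:
  assumes "0 < u" "0 < v" "u \<noteq> v" "0 < l" "l < 1"
  shows "arcsin_p (l * u + (1 - l) * v) x < arcsin_p u x powr l * arcsin_p v x powr (1 - l)"
  using assms convex_combination_pos cm_term_strict_convex[OF cm_term_asin_exponent]
  by (intro arcsin_p_less_geometric_mean) auto

lemma artanh_p_strict_log_convex:
  assumes uv: "0 < u" "0 < v" "u \<noteq> v" and l: "0 < l" "l < 1"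
  shows "artanh_p (l * u + (1 - l) * v) x < artanh_p u x powr l * artanh_p v x powr (1 - l)"
proof -
  note w = convex_combination_pos[OF uv(1,2) l]
  show ?thesis
    unfolding artanh_p_eq[OF uv(1)] artanh_p_eq[OF uv(2)] artanh_p_eq[OF w]
  proof (intro integral_less_geometric_mean integrable_artanh M_nonzero uv w l)
    fix t assume t: "t \<in> space M"
    \<comment> \<open>As an exponential of the \<open>log\<close> generator, the integrand reduces
      the claim to strict convexity of that generator.\<close>
    have exp_eq: "inverse (1 - t powr p) = exp (- ln (1 - t powr p))" if "p > 0" for p
      using one_minus_powr_pos[of t p] t that by (simp add: exp_minus)
    have "- ln (1 - t powr (l * u + (1 - l) * v))
        < l * - ln (1 - t powr u) + (1 - l) * - ln (1 - t powr v)"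
      by (rule cm_term_strict_convex[OF cm_term.log]) (use t x uv l in auto)
    then show "inverse (1 - t powr (l * u + (1 - l) * v))
        < inverse (1 - t powr u) powr l * inverse (1 - t powr v) powr (1 - l)"
      unfolding exp_eq[OF uv(1)] exp_eq[OF uv(2)] exp_eq[OF w]
      by (rule exp_strict_convex_combination)
  qed (use one_minus_powr_pos uv in auto)
qed

lemma arcsin_p_strict_geometrically_convex:
  assumes uv: "0 < u" "0 < v" "u \<noteq> v" and l: "0 < l" "l < 1"
  shows "arcsin_p (u powr l * v powr (1 - l)) x < arcsin_p u x powr l * arcsin_p v x powr (1 - l)"
proof (rule arcsin_p_less_geometric_mean)
  fix t assume t: "t \<in> space M"
  \<comment> \<open>In the variable \<open>ln p\<close> the geometric mean becomes an arithmetic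
    one, so convexity along \<open>exp\<close> applies.\<close>
  have "u powr l * v powr (1 - l) = exp (l * ln u + (1 - l) * ln v)"
    using uv by (simp add: powr_def exp_add)
  then show "asin_exponent (u powr l * v powr (1 - l)) t
      < l * asin_exponent u t + (1 - l) * asin_exponent v t"
    using cm_term_div_strict_convex_exp[OF cm_term.log[of t], of "ln u" "ln v" l] t x uv l
    by (simp add: asin_exponent_def)
qed (use uv l in auto)

section \<open>Monotonicity and concavity of \<open>arctan_p\<close>\<close>

lemma arctan_p_strict_mono: "strict_mono_on {0<..} (\<lambda>p. arctan_p p x)"
proof (rule strict_mono_onI)
  fix p q :: real assume pq: "p \<in> {0<..}" "q \<in> {0<..}" "p < q"
  then have "inverse (1 + t powr p) < inverse (1 + t powr q)" if "t \<in> space M" for t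
    using that x by (intro less_imp_inverse_less) (auto simp: powr_less_mono' add_pos_pos)
  then show "arctan_p p x < arctan_p q x"
    using pq integrable_arctan M_nonzero
    by (auto simp: arctan_p_eq intro!: integral_strict_mono)
qed

lemma arctan_p_strict_concave:
  assumes uv: "0 < u" "0 < v" "u \<noteq> v" and l: "0 < l" "l < 1"
  shows "l * arctan_p u x + (1 - l) * arctan_p v x < arctan_p (l * u + (1 - l) * v) x"
proof -
  note w = convex_combination_pos[OF uv(1,2) l]
  have "(\<integral>t. l * inverse (1 + t powr u) + (1 - l) * inverse (1 + t powr v) \<partial>M)
      < (\<integral>t. inverse (1 + t powr (l * u + (1 - l) * v)) \<partial>M)"
    using inverse_one_plus_powr_strict_concave uv l x w M_nonzero integrable_arctan
    by (intro integral_strict_mono) auto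
  then show ?thesis
    using uv w integrable_arctan by (simp add: arctan_p_eq)
qed

lemma arctan_p_pos: "0 < p \<Longrightarrow> 0 < arctan_p p x"
  using integrable_arctan M_nonzero
  by (auto simp: arctan_p_eq add_pos_nonneg intro!: integral_pos)

lemma concave_arctan_p: "concave_on {0<..} (\<lambda>p. arctan_p p x)"
  unfolding concave_on_def
proof (rule convex_onI)
  fix t u v :: real
  assume t: "0 < t" "t < 1" and uv: "u \<in> {0<..}" "v \<in> {0<..}"
  show "- arctan_p ((1 - t) *\<^sub>R u + t *\<^sub>R v) x \<le> (1 - t) * - arctan_p u x + t * - arctan_p v x"
  proof (cases "u = v")
    case True
    then show ?thesis by (simp add: algebra_simps)
  next
    case False
    then show ?thesis using arctan_p_strict_concave[of u v "1 - t"] t uv by simp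
  qed
qed auto

end

theorem theorem1:
  fixes x :: real
  assumes "0 < x" and "x < 1"
  shows "(strictly_completely_monotonic (\<lambda>p. arcsin_p p x) \<and>
          log_convex (\<lambda>p. arcsin_p p x) \<and>
          strictly_completely_monotonic (\<lambda>p. artanh_p p x) \<and>
          log_convex (\<lambda>p. artanh_p p x) \<and>
          strictly_geometrically_convex (\<lambda>p. arcsin_p p x)) \<and>
         (strict_mono_on {0<..} (\<lambda>p. arctan_p p x) \<and>
          concave_on {0<..} (\<lambda>p. arctan_p p x)) \<and>
         (\<forall>p>1.
            (arcsin_p p x)\<^sup>2 < arcsin_p (p - 1) x * arcsin_p (p + 1) x \<and>
            (artanh_p p x)\<^sup>2 < artanh_p (p - 1) x * artanh_p (p + 1) x \<and>
            (arctan_p p x)\<^sup>2 > arctan_p (p - 1) x * arctan_p (p + 1) x)"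
proof -
  note x = assms
  show ?thesis
    using strictly_completely_monotonic_arcsin_p[OF x] strictly_completely_monotonic_artanh_p[OF x]
      log_convexI[OF arcsin_p_pos[OF x] arcsin_p_strict_log_convex[OF x]]
      log_convexI[OF artanh_p_pos[OF x] artanh_p_strict_log_convex[OF x]]
      strictly_geometrically_convexI[OF arcsin_p_pos[OF x] arcsin_p_strict_geometrically_convex[OF x]]
      arctan_p_strict_mono[OF x] concave_arctan_p[OF x]
      turan_of_strict_log_convex[OF arcsin_p_pos[OF x] arcsin_p_strict_log_convex[OF x]]
      turan_of_strict_log_convex[OF artanh_p_pos[OF x] artanh_p_strict_log_convex[OF x]]
      turan_of_strict_concave[OF arctan_p_pos[OF x] arctan_p_strict_concave[OF x]]
    by blast
qed

end
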